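(* Let $B=\{f(X)\in\mathbb{R}[X]\mid f(0)=f(1)\}$. Then there is a group isomorphism $\Gamma(B)\cong\pi_1(SL_2(\mathbb{R}))$.
   Context: All rings are commutative with identity; $I_2$ is the $2\times 2$ identity matrix. For a ring $R$, a loop in $SL_2(R)$ is a matrix $\alpha(T)\in SL_2(R[T])$ with $\alpha(0)=\alpha(1)=I_2$. Two loops $\alpha(T),\beta(T)$ are equivalent if there is $\gamma(T,S)\in SL_2(R[T,S])$ with $\gamma(T,0)=\alpha(T)$, $\gamma(T,1)=\beta(T)$, $\gamma(0,S)=\gamma(1,S)=I_2$. The set $\pi_1(SL_2(R))$ of equivalence classes of loops is an abelian group under $[\alpha(T)]*[\beta(T)]=[\alpha(T)\beta(T)]$ (the algebraic fundamental group of $R$). Let $QL_2(R)$ be the normal subgroup of all $\alpha\in SL_2(R)$ connected to the identity, i.e. such that there is $\beta(T)\in SL_2(R[T])$ with $\beta(0)=I_2$, $\beta(1)=\alpha$. The algebraic cohomotopy group of $R$ is $\Gamma(R)=SL_2(R)/QL_2(R)$. (Equivalently, it is the set of classes of unimodular rows $(a,b)\in R^2$ under: $(a,b)\sim(c,d)$ if $\alpha (a,b)^t=(c,d)^t$ for some $\alpha\in QL_2(R)$; the product is the class of the first column of the product of completions in $SL_2(R)$.) *)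

theory Defs
  imports
    "HOL-Analysis.Determinants"
    "HOL-Algebra.Coset"
    "HOL-Computational_Algebra.Polynomial"
begin

section \<open>The special linear group and its polynomial loops\<close>

definition SL2_set :: "('a::comm_ring_1^2^2) set" where
  "SL2_set = {A. det A = 1}"

definition SL2 :: "'a::comm_ring_1 itself \<Rightarrow> ('a^2^2) monoid" where
  "SL2 R = \<lparr>carrier = SL2_set, monoid.mult = (**), one = mat 1\<rparr>"

definition eval_mat :: "'a::comm_ring_1 \<Rightarrow> 'a poly^2^2 \<Rightarrow> 'a^2^2" where
  "eval_mat c = map_matrix (\<lambda>p. poly p c)"

text \<open>
  \<open>R[T,S]\<close> is represented as \<open>R[T][S]\<close>, that is \<open>'a poly poly\<close> with outer variable \<open>S\<close>.
  Hence \<^const>\<open>eval_mat\<close> substitutes for \<open>S\<close>, and the following function for \<open>T\<close>,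
  leaving a matrix over \<open>R[S]\<close>.
\<close>

definition eval_inner_mat :: "'a::comm_ring_1 \<Rightarrow> 'a poly poly^2^2 \<Rightarrow> 'a poly^2^2" where
  "eval_inner_mat c = map_matrix (map_poly (\<lambda>p. poly p c))"

definition loops :: "('a::comm_ring_1 poly^2^2) set" where
  "loops = {\<alpha> \<in> SL2_set. eval_mat 0 \<alpha> = mat 1 \<and> eval_mat 1 \<alpha> = mat 1}"

definition loop_equiv :: "(('a::comm_ring_1 poly^2^2) \<times> ('a poly^2^2)) set" where
  "loop_equiv = {(\<alpha>, \<beta>). \<alpha> \<in> loops \<and> \<beta> \<in> loops \<and>
     (\<exists>\<gamma> \<in> SL2_set. eval_mat 0 \<gamma> = \<alpha> \<and> eval_mat 1 \<gamma> = \<beta> \<and>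
        eval_inner_mat 0 \<gamma> = mat 1 \<and> eval_inner_mat 1 \<gamma> = mat 1)}"

text \<open>
  The product of two classes does not depend on the representatives, so that the union below
  is the single class \<open>[\<alpha> ** \<beta>]\<close>: see \<open>pi1_mult_class\<close>.
\<close>

definition pi1_SL2 :: "'a::comm_ring_1 itself \<Rightarrow> ('a poly^2^2) set monoid" where
  "pi1_SL2 R =
     \<lparr>carrier = loops // loop_equiv,
      monoid.mult = (\<lambda>X Y. \<Union>\<alpha>\<in>X. \<Union>\<beta>\<in>Y. loop_equiv `` {\<alpha> ** \<beta>}),
      one = loop_equiv `` {mat 1}\<rparr>"

definition QL2 :: "('a::comm_ring_1^2^2) set" where
  "QL2 = {\<alpha> \<in> SL2_set. \<exists>\<beta> \<in> SL2_set. eval_mat 0 \<beta> = mat 1 \<and> eval_mat 1 \<beta> = \<alpha>}"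

definition cohomotopy_group :: "'a::comm_ring_1 itself \<Rightarrow> ('a^2^2) set monoid" where
  "cohomotopy_group R = SL2 R Mod QL2"


section \<open>The ring of real polynomials with equal values at 0 and 1\<close>

typedef nodal = "{f :: real poly. poly f 0 = poly f 1}"
  morphisms poly_of_nodal Abs_nodal
  by (rule exI[of _ 0]) simp

setup_lifting type_definition_nodal

instantiation nodal :: comm_ring_1
begin

lift_definition zero_nodal :: nodal is 0 by simp
lift_definition one_nodal :: nodal is 1 by simp
lift_definition plus_nodal :: "nodal \<Rightarrow> nodal \<Rightarrow> nodal" is "(+)" by simp
lift_definition minus_nodal :: "nodal \<Rightarrow> nodal \<Rightarrow> nodal" is "(-)" by simp
lift_definition uminus_nodal :: "nodal \<Rightarrow> nodal" is uminus by simp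
lift_definition times_nodal :: "nodal \<Rightarrow> nodal \<Rightarrow> nodal" is "(*)" by simp

instance
  by standard (transfer; simp add: algebra_simps)+

end


section \<open>The constructions above are groups\<close>

definition adj2 :: "'a::comm_ring_1^2^2 \<Rightarrow> 'a^2^2" where
  "adj2 A = (\<chi> i j. if i = j then (if i = 1 then A$2$2 else A$1$1) else - A$i$j)"

lemma adj2_nth [simp]:
  "adj2 A $ 1 $ 1 = A$2$2" "adj2 A $ 2 $ 2 = A$1$1"
  "adj2 A $ 1 $ 2 = - A$1$2" "adj2 A $ 2 $ 1 = - A$2$1"
  by (simp_all add: adj2_def)

lemma mat2_eq_iff:
  "(A :: 'a^2^2) = B \<longleftrightarrow> A$1$1 = B$1$1 \<and> A$1$2 = B$1$2 \<and> A$2$1 = B$2$1 \<and> A$2$2 = B$2$2"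
  by (auto simp: vec_eq_iff forall_2)

lemma mat2_mult_nth:
  "((A :: 'a::comm_ring_1^2^2) ** B) $ i $ j = A$i$1 * B$1$j + A$i$2 * B$2$j"
  by (simp add: matrix_matrix_mult_def sum_2)

lemma mat2_one_nth [simp]:
  "(mat 1 :: 'a::comm_ring_1^2^2) $ 1 $ 1 = 1" "(mat 1 :: 'a::comm_ring_1^2^2) $ 2 $ 2 = 1"
  "(mat 1 :: 'a::comm_ring_1^2^2) $ 1 $ 2 = 0" "(mat 1 :: 'a::comm_ring_1^2^2) $ 2 $ 1 = 0"
  by (simp_all add: mat_def)

lemma adj2_mult:
  assumes "det A = 1"
  shows "A ** adj2 A = mat 1" "adj2 A ** A = mat 1"
  using assms by (simp_all add: mat2_eq_iff mat2_mult_nth det_2 algebra_simps)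

lemma SL2_set_one: "mat 1 \<in> SL2_set"
  by (simp add: SL2_set_def)

lemma SL2_set_mult: "A \<in> SL2_set \<Longrightarrow> B \<in> SL2_set \<Longrightarrow> A ** B \<in> SL2_set"
  by (simp add: SL2_set_def det_mul)

lemma SL2_set_adj2: "A \<in> SL2_set \<Longrightarrow> adj2 A \<in> SL2_set"
  by (simp add: SL2_set_def det_2 mult.commute)

lemmas SL2_set_closed = SL2_set_one SL2_set_mult SL2_set_adj2

lemma mult_adj2: "A \<in> SL2_set \<Longrightarrow> A ** adj2 A = mat 1" "A \<in> SL2_set \<Longrightarrow> adj2 A ** A = mat 1"
  by (simp_all add: SL2_set_def adj2_mult)

lemma group_SL2: "group (SL2 R)"
  by (rule groupI) (auto simp: SL2_def SL2_set_closed matrix_mul_assoc intro: SL2_set_adj2 mult_adj2)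

lemma map_poly_eval_add:
  "map_poly (\<lambda>p. poly p c) (p + q) = map_poly (\<lambda>p. poly p c) p + map_poly (\<lambda>p. poly p c) q"
  for c :: "'a::comm_ring_1"
  by (rule poly_eqI) (simp add: coeff_map_poly)

lemma map_poly_eval_mult:
  "map_poly (\<lambda>p. poly p c) (p * q) = map_poly (\<lambda>p. poly p c) p * map_poly (\<lambda>p. poly p c) q"
  for c :: "'a::comm_ring_1"
  by (rule poly_eqI) (simp add: coeff_map_poly coeff_mult poly_sum)

lemma map_poly_eval_uminus:
  "map_poly (\<lambda>p. poly p c) (- p) = - map_poly (\<lambda>p. poly p c) p"
  for c :: "'a::comm_ring_1"
  by (rule poly_eqI) (simp add: coeff_map_poly)

lemma eval_mat_simps [simp]:
  "eval_mat c (mat 1) = mat 1" "eval_mat c (A ** B) = eval_mat c A ** eval_mat c B"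
  "eval_mat c (adj2 A) = adj2 (eval_mat c A)"
  by (simp_all add: eval_mat_def mat2_eq_iff mat2_mult_nth)

lemma eval_inner_mat_simps [simp]:
  "eval_inner_mat c (mat 1) = mat 1"
  "eval_inner_mat c (A ** B) = eval_inner_mat c A ** eval_inner_mat c B"
  "eval_inner_mat c (adj2 A) = adj2 (eval_inner_mat c A)"
  by (simp_all add: eval_inner_mat_def mat2_eq_iff mat2_mult_nth
      map_poly_eval_add map_poly_eval_mult map_poly_eval_uminus)

lemma adj2_one [simp]: "adj2 (mat 1) = mat 1"
  by (simp add: mat2_eq_iff)

lemma eval_mat_SL2: "A \<in> SL2_set \<Longrightarrow> eval_mat c A \<in> SL2_set"
  by (simp add: SL2_set_def eval_mat_def det_2 flip: poly_mult poly_diff)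

definition const_mat :: "'a::comm_ring_1^2^2 \<Rightarrow> 'a poly^2^2" where
  "const_mat = map_matrix (\<lambda>a. [:a:])"

lemma const_mat_SL2: "A \<in> SL2_set \<Longrightarrow> const_mat A \<in> SL2_set"
  by (simp add: SL2_set_def const_mat_def det_2 mult.commute one_pCons)

lemma eval_const_mat [simp]:
  "eval_mat c (const_mat A) = A"
  "eval_inner_mat c (const_mat B) = const_mat (eval_mat c B)"
  "const_mat (mat 1) = mat 1"
  by (simp_all add: eval_mat_def eval_inner_mat_def const_mat_def mat2_eq_iff map_poly_pCons flip: one_pCons)

lemma normal_QL2: "QL2 \<lhd> SL2 R"
proof -
  interpret group "SL2 R" by (rule group_SL2)
  have inv: "inv\<^bsub>SL2 R\<^esub> A = adj2 A" if "A \<in> SL2_set" for A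
    using that by (intro inv_equality) (simp_all add: SL2_def SL2_set_adj2 mult_adj2)
  have "subgroup QL2 (SL2 R)"
  proof
    show "QL2 \<subseteq> carrier (SL2 R)" by (auto simp: QL2_def SL2_def)
    show "\<one>\<^bsub>SL2 R\<^esub> \<in> QL2"
      by (auto simp: QL2_def SL2_def SL2_set_one intro!: bexI[of _ "mat 1"])
    fix A B :: "'a^2^2" assume "A \<in> QL2"
    then obtain \<alpha> where \<alpha>: "A \<in> SL2_set" "\<alpha> \<in> SL2_set" "eval_mat 0 \<alpha> = mat 1" "eval_mat 1 \<alpha> = A"
      by (auto simp: QL2_def)
    show "inv\<^bsub>SL2 R\<^esub> A \<in> QL2"
      using \<alpha> by (auto simp: QL2_def inv SL2_set_adj2 intro!: bexI[of _ "adj2 \<alpha>"])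
    assume "B \<in> QL2"
    then obtain \<beta> where "B \<in> SL2_set" "\<beta> \<in> SL2_set" "eval_mat 0 \<beta> = mat 1" "eval_mat 1 \<beta> = B"
      by (auto simp: QL2_def)
    with \<alpha> show "A \<otimes>\<^bsub>SL2 R\<^esub> B \<in> QL2"
      by (auto simp: QL2_def SL2_def SL2_set_mult intro!: bexI[of _ "\<alpha> ** \<beta>"])
  qed
  moreover have "x \<otimes>\<^bsub>SL2 R\<^esub> h \<otimes>\<^bsub>SL2 R\<^esub> inv\<^bsub>SL2 R\<^esub> x \<in> QL2"
    if "x \<in> carrier (SL2 R)" and h: "h \<in> QL2" for x h
  proof -
    have x: "x \<in> SL2_set" using that by (simp add: SL2_def)
    obtain \<beta> where \<beta>: "h \<in> SL2_set" "\<beta> \<in> SL2_set" "eval_mat 0 \<beta> = mat 1" "eval_mat 1 \<beta> = h"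
      using h by (auto simp: QL2_def)
    have "x ** h ** adj2 x \<in> QL2"
      unfolding QL2_def using x \<beta>
      by (auto simp: SL2_set_closed const_mat_SL2 mult_adj2
          intro!: bexI[of _ "const_mat x ** \<beta> ** adj2 (const_mat x)"])
    then show ?thesis by (simp add: inv x) (simp add: SL2_def)
  qed
  ultimately show ?thesis by (simp add: normal_inv_iff)
qed

lemma group_cohomotopy_group: "group (cohomotopy_group R)"
  unfolding cohomotopy_group_def by (rule normal.factorgroup_is_group[OF normal_QL2])

lemma loops_closed:
  "mat 1 \<in> loops" "\<alpha> \<in> loops \<Longrightarrow> \<beta> \<in> loops \<Longrightarrow> \<alpha> ** \<beta> \<in> loops" "\<alpha> \<in> loops \<Longrightarrow> adj2 \<alpha> \<in> loops"
  by (auto simp: loops_def SL2_set_closed)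

lemma loop_equivI:
  assumes "\<alpha> \<in> loops" "\<beta> \<in> loops" "\<gamma> \<in> SL2_set" "eval_mat 0 \<gamma> = \<alpha>" "eval_mat 1 \<gamma> = \<beta>"
    "eval_inner_mat 0 \<gamma> = mat 1" "eval_inner_mat 1 \<gamma> = mat 1"
  shows "(\<alpha>, \<beta>) \<in> loop_equiv"
  using assms by (auto simp: loop_equiv_def)

lemma loop_equiv_refl: "\<alpha> \<in> loops \<Longrightarrow> (\<alpha>, \<alpha>) \<in> loop_equiv"
  by (rule loop_equivI[where \<gamma> = "const_mat \<alpha>"]) (auto simp: loops_def const_mat_SL2)

lemma loop_equiv_mult:
  "(\<alpha>, \<alpha>') \<in> loop_equiv \<Longrightarrow> (\<beta>, \<beta>') \<in> loop_equiv \<Longrightarrow> (\<alpha> ** \<beta>, \<alpha>' ** \<beta>') \<in> loop_equiv"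
  unfolding loop_equiv_def
  by (clarsimp simp: loops_closed) (rule_tac x = "\<gamma> ** \<gamma>'" in bexI; simp add: SL2_set_mult)

lemma loop_equiv_adj2: "(\<alpha>, \<beta>) \<in> loop_equiv \<Longrightarrow> (adj2 \<alpha>, adj2 \<beta>) \<in> loop_equiv"
  unfolding loop_equiv_def
  by (clarsimp simp: loops_closed) (rule_tac x = "adj2 \<gamma>" in bexI; simp add: SL2_set_adj2)

lemma loop_equiv_loops: "(\<alpha>, \<beta>) \<in> loop_equiv \<Longrightarrow> \<alpha> \<in> loops \<and> \<beta> \<in> loops"
  by (simp add: loop_equiv_def)

lemma loops_SL2: "\<alpha> \<in> loops \<Longrightarrow> \<alpha> \<in> SL2_set"
  by (simp add: loops_def)

lemma equiv_loop_equiv: "equiv loops loop_equiv"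
proof (rule equivI)
  show "loop_equiv \<subseteq> loops \<times> (loops :: ('a poly^2^2) set)" by (auto simp: loop_equiv_def)
  show "refl_on loops (loop_equiv :: (('a poly^2^2) \<times> _) set)"
    by (auto simp: refl_on_def loop_equiv_refl)
  have sym: "(\<beta>, \<alpha>) \<in> loop_equiv" if "(\<alpha>, \<beta>) \<in> loop_equiv" for \<alpha> \<beta> :: "'a poly^2^2"
  proof -
    have l: "\<alpha> \<in> loops" "\<beta> \<in> loops" using loop_equiv_loops[OF that] by auto
    have "(\<beta> ** adj2 \<alpha> ** \<alpha>, \<beta> ** adj2 \<beta> ** \<alpha>) \<in> loop_equiv"
      using that l by (intro loop_equiv_mult loop_equiv_adj2 loop_equiv_refl)
    then show ?thesis using l by (simp add: loops_SL2 mult_adj2 flip: matrix_mul_assoc)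
  qed
  then show "sym (loop_equiv :: (('a poly^2^2) \<times> _) set)" by (rule symI)
  have "(\<alpha>, \<delta>) \<in> loop_equiv" if "(\<alpha>, \<beta>) \<in> loop_equiv" "(\<beta>, \<delta>) \<in> loop_equiv"
    for \<alpha> \<beta> \<delta> :: "'a poly^2^2"
  proof -
    have l: "\<alpha> \<in> loops" "\<beta> \<in> loops" "\<delta> \<in> loops"
      using loop_equiv_loops that by auto
    have "(\<alpha> ** (adj2 \<beta> ** \<beta>), \<beta> ** (adj2 \<beta> ** \<delta>)) \<in> loop_equiv"
      using that l by (intro loop_equiv_mult loop_equiv_adj2 loop_equiv_refl loops_closed)
    then show ?thesis using l by (simp add: loops_SL2 mult_adj2)
        (simp add: loops_SL2 mult_adj2 matrix_mul_assoc)
  qed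
  then show "trans (loop_equiv :: (('a poly^2^2) \<times> _) set)" by (rule transI)
qed

lemma pi1_mult_class:
  assumes "\<alpha> \<in> loops" "\<beta> \<in> loops"
  shows "loop_equiv `` {\<alpha>} \<otimes>\<^bsub>pi1_SL2 R\<^esub> loop_equiv `` {\<beta>} = loop_equiv `` {\<alpha> ** \<beta>}"
proof -
  have "loop_equiv `` {\<alpha>' ** \<beta>'} = loop_equiv `` {\<alpha> ** \<beta>}"
    if "\<alpha>' \<in> loop_equiv `` {\<alpha>}" "\<beta>' \<in> loop_equiv `` {\<beta>}" for \<alpha>' \<beta>'
    using that equiv_class_eq[OF equiv_loop_equiv loop_equiv_mult, of \<alpha> \<alpha>' \<beta> \<beta>'] by simp
  moreover have "\<alpha> \<in> loop_equiv `` {\<alpha>}" "\<beta> \<in> loop_equiv `` {\<beta>}"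
    using assms by (auto intro: loop_equiv_refl)
  ultimately have "(\<Union>\<alpha>'\<in>loop_equiv `` {\<alpha>}. \<Union>\<beta>'\<in>loop_equiv `` {\<beta>}. loop_equiv `` {\<alpha>' ** \<beta>'})
      = (\<Union>\<alpha>'\<in>loop_equiv `` {\<alpha>}. \<Union>\<beta>'\<in>loop_equiv `` {\<beta>}. loop_equiv `` {\<alpha> ** \<beta>})"
    by (intro SUP_cong refl) blast
  also have "\<dots> = loop_equiv `` {\<alpha> ** \<beta>}"
    using \<open>\<alpha> \<in> loop_equiv `` {\<alpha>}\<close> \<open>\<beta> \<in> loop_equiv `` {\<beta>}\<close> by blast
  finally show ?thesis by (simp only: pi1_SL2_def monoid.simps)
qed

lemma pi1_carrierE:
  assumes "X \<in> carrier (pi1_SL2 R)"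
  obtains \<alpha> where "\<alpha> \<in> loops" "X = loop_equiv `` {\<alpha>}"
  using assms by (auto simp: pi1_SL2_def elim: quotientE)

lemma pi1_carrierI: "\<alpha> \<in> loops \<Longrightarrow> loop_equiv `` {\<alpha>} \<in> carrier (pi1_SL2 R)"
  by (simp add: pi1_SL2_def quotientI)

lemma pi1_one: "\<one>\<^bsub>pi1_SL2 R\<^esub> = loop_equiv `` {mat 1}"
  by (simp add: pi1_SL2_def)

lemma group_pi1_SL2: "group (pi1_SL2 R)"
proof (rule groupI)
  fix x assume "x \<in> carrier (pi1_SL2 R)"
  then obtain \<alpha> where x: "\<alpha> \<in> loops" "x = loop_equiv `` {\<alpha>}" by (rule pi1_carrierE)
  show "\<one>\<^bsub>pi1_SL2 R\<^esub> \<otimes>\<^bsub>pi1_SL2 R\<^esub> x = x"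
    using x by (simp add: pi1_one pi1_mult_class loops_closed)
  show "\<exists>y\<in>carrier (pi1_SL2 R). y \<otimes>\<^bsub>pi1_SL2 R\<^esub> x = \<one>\<^bsub>pi1_SL2 R\<^esub>"
    using x by (intro bexI[of _ "loop_equiv `` {adj2 \<alpha>}"])
      (simp_all add: pi1_one pi1_mult_class loops_closed pi1_carrierI mult_adj2 loops_SL2)
next
  fix x y assume "x \<in> carrier (pi1_SL2 R)" "y \<in> carrier (pi1_SL2 R)"
  then obtain \<alpha> \<beta> where *: "\<alpha> \<in> loops" "x = loop_equiv `` {\<alpha>}" "\<beta> \<in> loops" "y = loop_equiv `` {\<beta>}"
    by (elim pi1_carrierE) blast
  then show "x \<otimes>\<^bsub>pi1_SL2 R\<^esub> y \<in> carrier (pi1_SL2 R)"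
    by (simp add: pi1_mult_class loops_closed pi1_carrierI)
  fix z assume "z \<in> carrier (pi1_SL2 R)"
  then obtain \<delta> where "\<delta> \<in> loops" "z = loop_equiv `` {\<delta>}" by (rule pi1_carrierE)
  with * show "x \<otimes>\<^bsub>pi1_SL2 R\<^esub> y \<otimes>\<^bsub>pi1_SL2 R\<^esub> z = x \<otimes>\<^bsub>pi1_SL2 R\<^esub> (y \<otimes>\<^bsub>pi1_SL2 R\<^esub> z)"
    by (simp add: pi1_mult_class loops_closed matrix_mul_assoc)
qed (simp add: pi1_one pi1_carrierI loops_closed)

end

(*
  A matrix over B is a matrix alpha over R[X] with alpha(0) = alpha(1), and alpha is sent to the
  class of the loop alpha(0)^-1 alpha. Every matrix of SL_2(R) is a product of elementary matrices,
  hence is connected to the identity by a polynomial path. Conjugating a loop by such a path is a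
  homotopy of loops, so the map is multiplicative. Its kernel is QL_2(B): a path beta(X,T) in
  SL_2(B) and a contraction gamma(X,T) of the loop determine each other by
  beta(X,T) = c(T) gamma(X,T), where c is a path in SL_2(R) from the identity to alpha(0).
*)
theory Submission
  imports Defs
begin

section \<open>Matrices and ring homomorphisms\<close>

text \<open>The inclusion of constants, the inclusion of B into R[X], evaluation at a point and the
  coefficientwise lifts of these are all ring homomorphisms, so determinants and substitutions in
  matrices are handled once for all of them.\<close>

locale comm_ring_hom =
  fixes h :: "'a::comm_ring_1 \<Rightarrow> 'b::comm_ring_1"
  assumes hom_one: "h 1 = 1"
    and hom_add: "h (x + y) = h x + h y"
    and hom_mult: "h (x * y) = h x * h y"
begin

lemma hom_zero: "h 0 = 0"
  using hom_add[of 0 0] by simp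

lemma hom_uminus: "h (- x) = - h x"
  using hom_add[of x "- x"] by (simp add: hom_zero eq_neg_iff_add_eq_0 add.commute)

lemma hom_diff: "h (x - y) = h x - h y"
  using hom_add[of x "- y"] by (simp add: hom_uminus)

lemma hom_sum: "h (sum f A) = (\<Sum>i\<in>A. h (f i))"
  by (induction A rule: infinite_finite_induct) (simp_all add: hom_zero hom_add)

lemma comm_ring_hom_map_poly: "comm_ring_hom (map_poly h)"
proof
  show "map_poly h 1 = 1"
    by (simp add: hom_zero hom_one one_pCons map_poly_pCons)
  show "map_poly h (p + q) = map_poly h p + map_poly h q" for p q
    by (rule poly_eqI) (simp add: coeff_map_poly hom_zero hom_add)
  show "map_poly h (p * q) = map_poly h p * map_poly h q" for p q
    by (rule poly_eqI) (simp add: coeff_map_poly coeff_mult hom_zero hom_sum hom_mult)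
qed

lemma hom_poly: "h (poly p c) = poly (map_poly h p) (h c)"
  by (induction p) (simp_all add: hom_zero hom_add hom_mult map_poly_pCons)

lemma map_matrix_hom_one: "map_matrix h (mat 1 :: 'a^2^2) = mat 1"
  by (simp add: mat2_eq_iff hom_zero hom_one)

lemma map_matrix_hom_mult: "map_matrix h ((A :: 'a^2^2) ** (B :: 'a^2^2)) = map_matrix h A ** map_matrix h B"
  by (simp add: mat2_eq_iff mat2_mult_nth hom_add hom_mult)

lemma map_matrix_hom_adj2: "map_matrix h (adj2 A) = adj2 (map_matrix h A)"
  by (simp add: mat2_eq_iff hom_uminus)

lemma det_map_matrix_hom: "det (map_matrix h (A :: 'a^2^2)) = h (det A)"
  by (simp add: det_2 hom_diff hom_mult)

lemma map_matrix_hom_SL2: "A \<in> SL2_set \<Longrightarrow> map_matrix h A \<in> SL2_set"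
  by (simp add: SL2_set_def det_map_matrix_hom hom_one)

lemma map_matrix_hom_SL2_iff: "inj h \<Longrightarrow> map_matrix h A \<in> SL2_set \<longleftrightarrow> A \<in> SL2_set"
  using inj_eq[of h "det A" 1] by (simp add: SL2_set_def det_map_matrix_hom hom_one)

lemma map_matrix_hom_eval_mat:
  "map_matrix h (eval_mat c A) = eval_mat (h c) (map_matrix (map_poly h) A)"
  by (simp add: eval_mat_def mat2_eq_iff hom_poly)

lemmas map_matrix_hom_eval_mat_0_1 =
  map_matrix_hom_eval_mat[of 0, unfolded hom_zero] map_matrix_hom_eval_mat[of 1, unfolded hom_one]

end

lemma inj_map_matrix: "inj h \<Longrightarrow> inj (map_matrix h :: 'a^2^2 \<Rightarrow> 'b^2^2)"
  by (rule injI) (simp add: mat2_eq_iff inj_eq)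

interpretation const_poly: comm_ring_hom "\<lambda>a :: 'a::comm_ring_1. [:a:]"
  by unfold_locales (simp_all add: one_pCons)

lemmas const_mat_hom =
  const_poly.map_matrix_hom_mult[folded const_mat_def]
  const_poly.map_matrix_hom_adj2[folded const_mat_def]


section \<open>Polynomial paths in the special linear group\<close>

text \<open>A one-variable matrix embeds into two variables in two ways: here its variable becomes
  the outer variable S, while \<open>const_mat\<close> makes it the inner variable T.\<close>

definition path_mat :: "'a::comm_ring_1 poly^2^2 \<Rightarrow> 'a poly poly^2^2" where
  "path_mat = map_matrix (map_poly (\<lambda>a. [:a:]))"

lemma path_mat_SL2: "A \<in> SL2_set \<Longrightarrow> path_mat A \<in> SL2_set"
  unfolding path_mat_def
  by (rule comm_ring_hom.map_matrix_hom_SL2[OF const_poly.comm_ring_hom_map_poly])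

lemma eval_path_mat [simp]:
  "eval_mat 0 (path_mat A) = const_mat (eval_mat 0 A)"
  "eval_mat 1 (path_mat A) = const_mat (eval_mat 1 A)"
  using const_poly.map_matrix_hom_eval_mat_0_1[of A]
  by (simp_all add: path_mat_def const_mat_def)

lemma eval_inner_path_mat [simp]: "eval_inner_mat c (path_mat A) = A"
proof -
  have "map_poly (\<lambda>p. poly p c) (map_poly (\<lambda>a. [:a:]) q) = q" for q
    by (rule poly_eqI) (simp add: coeff_map_poly)
  then show ?thesis
    by (simp add: eval_inner_mat_def path_mat_def mat2_eq_iff)
qed

section \<open>Elementary matrices and connectedness of SL_2 over a field\<close>

lemma QL2_mult: "A \<in> QL2 \<Longrightarrow> B \<in> QL2 \<Longrightarrow> A ** B \<in> QL2"
  using normal_imp_subgroup[OF normal_QL2, THEN subgroup.m_closed] by (simp add: SL2_def)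

definition upper_mat :: "'a::comm_ring_1 \<Rightarrow> 'a^2^2" where
  "upper_mat x = (\<chi> i j. if i = j then 1 else if i = 1 then x else 0)"

definition lower_mat :: "'a::comm_ring_1 \<Rightarrow> 'a^2^2" where
  "lower_mat x = (\<chi> i j. if i = j then 1 else if i = 1 then 0 else x)"

lemma upper_mat_QL2: "upper_mat x \<in> QL2"
  unfolding QL2_def SL2_set_def
  by (auto simp: det_2 upper_mat_def eval_mat_def mat2_eq_iff intro!: exI[of _ "upper_mat [:0, x:]"])

lemma lower_mat_QL2: "lower_mat x \<in> QL2"
  unfolding QL2_def SL2_set_def
  by (auto simp: det_2 lower_mat_def eval_mat_def mat2_eq_iff intro!: exI[of _ "lower_mat [:0, x:]"])

text \<open>Elementary matrices lie in \<open>QL2\<close>, so it suffices to factor into them. If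
  the lower left entry is invertible, three factors are enough; otherwise one row operation reduces
  to that case.\<close>

lemma QL2_field: "(QL2 :: ('a::field^2^2) set) = SL2_set"
proof (intro equalityI subsetI)
  have nonzero: "A \<in> QL2" if "det A = 1" and c: "A $ 2 $ 1 \<noteq> 0" for A :: "'a^2^2"
  proof -
    \<comment> \<open>The diagonal entries of the product force these values; the upper right entry
      then agrees because the determinant is 1.\<close>
    let ?x = "(A $ 1 $ 1 - 1) / A $ 2 $ 1" and ?y = "(A $ 2 $ 2 - 1) / A $ 2 $ 1"
    have "A = upper_mat ?x ** lower_mat (A $ 2 $ 1) ** upper_mat ?y"
      using that
      by (simp add: mat2_eq_iff mat2_mult_nth upper_mat_def lower_mat_def det_2 field_simps)
    also have "\<dots> \<in> QL2"
      by (intro QL2_mult upper_mat_QL2 lower_mat_QL2)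
    finally show ?thesis .
  qed
  fix A :: "'a^2^2"
  assume "A \<in> SL2_set"
  then have det: "det A = 1" by (simp add: SL2_set_def)
  show "A \<in> QL2"
  proof (cases "A $ 2 $ 1 = 0")
    case True
    with det have "A $ 1 $ 1 \<noteq> 0" by (auto simp: det_2)
    \<comment> \<open>Adding the first row to the second moves the nonzero entry
      \<open>A $ 1 $ 1\<close> to the lower left.\<close>
    with True det have "lower_mat 1 ** A \<in> QL2"
      by (intro nonzero) (simp_all add: det_mul det_2 mat2_mult_nth lower_mat_def algebra_simps)
    then have "lower_mat (- 1) ** (lower_mat 1 ** A) \<in> QL2"
      by (rule QL2_mult[OF lower_mat_QL2])
    also have "lower_mat (- 1) ** (lower_mat 1 ** A) = A"
      by (simp add: mat2_eq_iff mat2_mult_nth lower_mat_def)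
    finally show ?thesis .
  qed (use det nonzero in blast)
qed (simp add: QL2_def)

lemma SL2_field_path:
  fixes A :: "'a::field^2^2"
  assumes "A \<in> SL2_set"
  obtains c where "c \<in> SL2_set" "eval_mat 0 c = mat 1" "eval_mat 1 c = A"
  using assms unfolding QL2_field[symmetric] by (auto simp: QL2_def)

text \<open>With c a path from the identity to A, the homotopy is c(S)^-1 \<alpha>(T) c(S). At T = 0
  and T = 1 the middle factor is the identity, so the ends stay fixed.\<close>

lemma loop_equiv_conj:
  fixes A :: "'a::field^2^2"
  assumes "A \<in> SL2_set" and l: "\<alpha> \<in> loops"
  shows "(\<alpha>, const_mat (adj2 A) ** \<alpha> ** const_mat A) \<in> loop_equiv"
proof -
  obtain c where c: "c \<in> SL2_set" "eval_mat 0 c = mat 1" "eval_mat 1 c = A"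
    using assms by (elim SL2_field_path)
  show ?thesis
    by (rule loop_equivI[where \<gamma> = "adj2 (path_mat c) ** const_mat \<alpha> ** path_mat c"])
      (use assms c in \<open>auto simp: loops_def SL2_set_closed const_mat_SL2 path_mat_SL2 mult_adj2
        const_mat_hom\<close>)
qed


section \<open>Matrices over the nodal ring\<close>

interpretation nodal: comm_ring_hom poly_of_nodal
  by unfold_locales (simp_all add: one_nodal.rep_eq plus_nodal.rep_eq times_nodal.rep_eq)

interpretation nodal_poly: comm_ring_hom "map_poly poly_of_nodal"
  by (rule nodal.comm_ring_hom_map_poly)

lemma inj_poly_of_nodal: "inj poly_of_nodal"
  by (simp add: inj_def poly_of_nodal_inject)

lemma inj_map_poly_of_nodal: "inj (map_poly poly_of_nodal)"
proof (rule injI, rule poly_eqI)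
  fix p q n
  assume "map_poly poly_of_nodal p = map_poly poly_of_nodal q"
  then have "coeff (map_poly poly_of_nodal p) n = coeff (map_poly poly_of_nodal q) n" by simp
  then show "coeff p n = coeff q n"
    by (simp add: coeff_map_poly nodal.hom_zero poly_of_nodal_inject)
qed

lemma poly_of_nodal_0_1: "poly (poly_of_nodal f) 0 = poly (poly_of_nodal f) 1"
  using poly_of_nodal[of f] by simp

lemma eval_map_matrix_nodal:
  "eval_mat 0 (map_matrix poly_of_nodal A) = eval_mat 1 (map_matrix poly_of_nodal A)"
  by (simp add: eval_mat_def mat2_eq_iff poly_of_nodal_0_1)

lemma eval_inner_map_matrix_nodal:
  "eval_inner_mat 0 (map_matrix (map_poly poly_of_nodal) A) =
   eval_inner_mat 1 (map_matrix (map_poly poly_of_nodal) A)"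
proof -
  have "map_poly (\<lambda>p. poly p 0) (map_poly poly_of_nodal q) =
    map_poly (\<lambda>p. poly p 1) (map_poly poly_of_nodal q)" for q
    by (rule poly_eqI) (simp add: coeff_map_poly nodal.hom_zero poly_of_nodal_0_1)
  then show ?thesis
    by (simp add: eval_inner_mat_def mat2_eq_iff)
qed

lemma nodal_matE:
  assumes "eval_mat 0 A = eval_mat 1 (A :: real poly^2^2)"
  obtains B where "map_matrix poly_of_nodal B = A"
proof
  show "map_matrix poly_of_nodal (map_matrix Abs_nodal A) = A"
    using assms by (simp add: eval_mat_def mat2_eq_iff Abs_nodal_inverse)
qed

text \<open>Equality of the two inner evaluations, read coefficientwise in the outer variable, says
  that every coefficient lies in B.\<close>

lemma nodal_poly_matE:
  assumes "eval_inner_mat 0 A = eval_inner_mat 1 (A :: real poly poly^2^2)"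
  obtains B where "map_matrix (map_poly poly_of_nodal) B = A"
proof
  \<comment> \<open>\<open>coeff_map_poly\<close> applies only to functions that preserve
    zero.\<close>
  have "Abs_nodal 0 = 0" by (simp add: zero_nodal_def)
  have "map_poly poly_of_nodal (map_poly Abs_nodal p) = p"
    if "map_poly (\<lambda>p. poly p 0) p = map_poly (\<lambda>p. poly p 1) p" for p
  proof (rule poly_eqI)
    fix n
    have "poly (coeff p n) 0 = poly (coeff p n) 1"
      using arg_cong[OF that, of "\<lambda>q. coeff q n"] by (simp add: coeff_map_poly)
    then show "coeff (map_poly poly_of_nodal (map_poly Abs_nodal p)) n = coeff p n"
      by (simp add: coeff_map_poly nodal.hom_zero \<open>Abs_nodal 0 = 0\<close> Abs_nodal_inverse)
  qed
  then show "map_matrix (map_poly poly_of_nodal) (map_matrix (map_poly Abs_nodal) A) = A"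
    using assms by (simp add: eval_inner_mat_def mat2_eq_iff)
qed


section \<open>The comparison map\<close>

text \<open>The value at the node, that is, at the point obtained by gluing 0 to 1.\<close>

definition base_pt :: "nodal^2^2 \<Rightarrow> real^2^2" where
  "base_pt A = eval_mat 0 (map_matrix poly_of_nodal A)"

definition based_loop :: "nodal^2^2 \<Rightarrow> real poly^2^2" where
  "based_loop A = const_mat (adj2 (base_pt A)) ** map_matrix poly_of_nodal A"

lemma base_pt_SL2: "A \<in> SL2_set \<Longrightarrow> base_pt A \<in> SL2_set"
  by (simp add: base_pt_def eval_mat_SL2 nodal.map_matrix_hom_SL2)

lemma based_loop_loops:
  assumes "A \<in> SL2_set"
  shows "based_loop A \<in> loops"
proof -
  have "based_loop A \<in> SL2_set"
    using assms by (simp add: based_loop_def SL2_set_closed const_mat_SL2 base_pt_SL2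
        nodal.map_matrix_hom_SL2)
  moreover have "eval_mat 0 (based_loop A) = adj2 (base_pt A) ** base_pt A"
    by (simp add: based_loop_def base_pt_def)
  moreover have "eval_mat 1 (based_loop A) = adj2 (base_pt A) ** base_pt A"
    by (simp add: based_loop_def base_pt_def eval_map_matrix_nodal)
  ultimately show ?thesis
    using base_pt_SL2[OF assms] by (simp add: loops_def mult_adj2)
qed

lemma const_base_pt_mult_based_loop:
  assumes "A \<in> SL2_set"
  shows "const_mat (base_pt A) ** based_loop A = map_matrix poly_of_nodal A"
  using mult_adj2(1)[OF const_mat_SL2[OF base_pt_SL2[OF assms]]]
  by (simp add: based_loop_def matrix_mul_assoc const_mat_hom)

section \<open>Multiplicativity, surjectivity and kernel of the comparison map\<close>

lemma base_pt_mult: "base_pt (A ** B) = base_pt A ** base_pt B"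
  by (simp add: base_pt_def nodal.map_matrix_hom_mult)

lemma adj2_mat_mult: "adj2 (A ** B) = adj2 B ** adj2 A"
  by (simp add: mat2_eq_iff mat2_mult_nth algebra_simps)

text \<open>With b the base point of B, the loop of the product is the loop of A conjugated by b,
  times the loop of B. The conjugation is removed by \<open>loop_equiv_conj\<close>.\<close>

lemma based_loop_mult:
  assumes "A \<in> SL2_set" "B \<in> SL2_set"
  shows "(based_loop A ** based_loop B, based_loop (A ** B)) \<in> loop_equiv"
proof -
  let ?b = "const_mat (base_pt B)"
  have "based_loop (A ** B) =
    const_mat (adj2 (base_pt B)) ** based_loop A ** map_matrix poly_of_nodal B"
    by (simp add: based_loop_def base_pt_mult adj2_mat_mult const_mat_hom
        nodal.map_matrix_hom_mult matrix_mul_assoc)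
  also have "\<dots> = (const_mat (adj2 (base_pt B)) ** based_loop A ** ?b) ** based_loop B"
    using const_base_pt_mult_based_loop[OF assms(2)] by (simp flip: matrix_mul_assoc)
  finally show ?thesis
    using assms by (auto intro!: loop_equiv_mult loop_equiv_conj loop_equiv_refl
        based_loop_loops base_pt_SL2)
qed

text \<open>A loop takes equal values at 0 and 1, so it is already a matrix over B; its base point
  is the identity, so no translation occurs.\<close>

lemma based_loop_surj:
  assumes "\<alpha> \<in> loops"
  obtains A where "A \<in> SL2_set" "based_loop A = \<alpha>"
proof -
  have \<alpha>: "\<alpha> \<in> SL2_set" "eval_mat 0 \<alpha> = mat 1" "eval_mat 1 \<alpha> = mat 1"
    using assms by (auto simp: loops_def)
  obtain A where A: "map_matrix poly_of_nodal A = \<alpha>"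
    using \<alpha> by (metis nodal_matE)
  show thesis
  proof
    show "A \<in> SL2_set"
      using \<alpha>(1) A nodal.map_matrix_hom_SL2_iff[OF inj_poly_of_nodal, of A] by simp
    show "based_loop A = \<alpha>"
      using A \<alpha> by (simp add: based_loop_def base_pt_def)
  qed
qed

lemma based_loop_contractible_iff:
  assumes A: "A \<in> SL2_set"
  shows "(mat 1, based_loop A) \<in> loop_equiv \<longleftrightarrow> A \<in> QL2"
proof
  assume "A \<in> QL2"
  then obtain \<beta> where \<beta>: "\<beta> \<in> SL2_set" "eval_mat 0 \<beta> = mat 1" "eval_mat 1 \<beta> = A"
    by (auto simp: QL2_def)
  define \<beta>' where "\<beta>' = map_matrix (map_poly poly_of_nodal) \<beta>"
  \<comment> \<open>The restriction of the path to the node, a path in SL_2 over the reals.\<close>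
  define c where "c = eval_inner_mat 0 \<beta>'"
  have \<beta>': "\<beta>' \<in> SL2_set" "eval_mat 0 \<beta>' = mat 1" "eval_mat 1 \<beta>' = map_matrix poly_of_nodal A"
    using \<beta> nodal.map_matrix_hom_eval_mat_0_1[of \<beta>]
    by (simp_all add: \<beta>'_def nodal_poly.map_matrix_hom_SL2 nodal.map_matrix_hom_one)
  have eval_inner: "eval_inner_mat 1 \<beta>' = c"
    by (simp add: c_def \<beta>'_def eval_inner_map_matrix_nodal)
  have "c \<in> SL2_set"
  proof -
    have "comm_ring_hom (\<lambda>p :: real poly. poly p 0)"
      by unfold_locales simp_all
    then interpret comm_ring_hom "map_poly (\<lambda>p :: real poly. poly p 0)"
      by (rule comm_ring_hom.comm_ring_hom_map_poly)
    show ?thesis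
      using map_matrix_hom_SL2 \<beta>'(1) by (simp add: c_def eval_inner_mat_def)
  qed
  \<comment> \<open>Substitutions for the two variables commute; \<open>[:x:]\<close> is the outer
    value x seen as a constant in the inner variable.\<close>
  have eval_c: "eval_mat x c = eval_mat 0 (eval_mat [:x:] \<beta>')" for x
  proof -
    interpret comm_ring_hom "\<lambda>p :: real poly. poly p 0"
      by unfold_locales simp_all
    show ?thesis
      using map_matrix_hom_eval_mat[of "[:x:]" \<beta>'] by (simp add: c_def eval_mat_def eval_inner_mat_def)
  qed
  have c01: "eval_mat 0 c = mat 1" "eval_mat 1 c = base_pt A"
    using \<beta>' by (simp_all add: eval_c base_pt_def flip: one_pCons)
  show "(mat 1, based_loop A) \<in> loop_equiv"
  proof (rule loop_equivI)
    \<comment> \<open>Dividing on the left by the values at the node makes both inner evaluations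
      trivial, as a homotopy of loops requires.\<close>
    show "adj2 (path_mat c) ** \<beta>' \<in> SL2_set"
      using \<open>c \<in> SL2_set\<close> \<beta>' by (simp add: SL2_set_closed path_mat_SL2)
    show "eval_inner_mat 0 (adj2 (path_mat c) ** \<beta>') = mat 1"
      using \<open>c \<in> SL2_set\<close> by (simp add: mult_adj2 flip: c_def)
    show "eval_inner_mat 1 (adj2 (path_mat c) ** \<beta>') = mat 1"
      using \<open>c \<in> SL2_set\<close> by (simp add: mult_adj2 eval_inner)
    show "eval_mat 0 (adj2 (path_mat c) ** \<beta>') = mat 1"
      using \<beta>' c01 by simp
    show "eval_mat 1 (adj2 (path_mat c) ** \<beta>') = based_loop A"
      using \<beta>' c01 by (simp add: based_loop_def const_mat_hom)
  qed (use A in \<open>simp_all add: loops_closed based_loop_loops\<close>)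
next
  assume "(mat 1, based_loop A) \<in> loop_equiv"
  then obtain \<gamma> where \<gamma>: "\<gamma> \<in> SL2_set" "eval_mat 0 \<gamma> = mat 1" "eval_mat 1 \<gamma> = based_loop A"
    "eval_inner_mat 0 \<gamma> = mat 1" "eval_inner_mat 1 \<gamma> = mat 1"
    by (auto simp: loop_equiv_def)
  obtain c where c: "c \<in> SL2_set" "eval_mat 0 c = mat 1" "eval_mat 1 c = base_pt A"
    using base_pt_SL2[OF A] by (elim SL2_field_path)
  \<comment> \<open>Both sides are c, since \<gamma> is trivial at both ends of the inner variable;
    hence the product has entries in B[S].\<close>
  have "eval_inner_mat 0 (path_mat c ** \<gamma>) = eval_inner_mat 1 (path_mat c ** \<gamma>)"
    using \<gamma> by simp
  then obtain \<beta> where \<beta>: "map_matrix (map_poly poly_of_nodal) \<beta> = path_mat c ** \<gamma>"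
    by (elim nodal_poly_matE)
  have "\<beta> \<in> SL2_set"
    using nodal_poly.map_matrix_hom_SL2_iff[OF inj_map_poly_of_nodal, of \<beta>] c \<gamma>
    by (simp add: \<beta> SL2_set_closed path_mat_SL2)
  \<comment> \<open>The endpoints of \<beta> are compared over R[X], into which B embeds.\<close>
  moreover have "map_matrix poly_of_nodal (eval_mat 0 \<beta>) = map_matrix poly_of_nodal (mat 1)"
    using c \<gamma> by (simp add: nodal.map_matrix_hom_eval_mat_0_1 \<beta> nodal.map_matrix_hom_one)
  moreover have "map_matrix poly_of_nodal (eval_mat 1 \<beta>) = map_matrix poly_of_nodal A"
    using c \<gamma> by (simp add: nodal.map_matrix_hom_eval_mat_0_1 \<beta> const_base_pt_mult_based_loop A)
  ultimately show "A \<in> QL2"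
    using A unfolding QL2_def inj_eq[OF inj_map_matrix[OF inj_poly_of_nodal]] by blast
qed

theorem mainTheorem3:
  shows "cohomotopy_group TYPE(nodal) \<cong> pi1_SL2 TYPE(real)"
proof -
  let ?G = "SL2 TYPE(nodal)" and ?H = "pi1_SL2 TYPE(real)"
  define \<phi> where "\<phi> A = loop_equiv `` {based_loop A}" for A
  have "\<phi> \<in> hom ?G ?H"
  proof (rule homI)
    fix A B
    assume "A \<in> carrier ?G" "B \<in> carrier ?G"
    then have AB: "A \<in> SL2_set" "B \<in> SL2_set" by (simp_all add: SL2_def)
    show "\<phi> A \<in> carrier ?H"
      using AB by (simp add: \<phi>_def pi1_carrierI based_loop_loops)
    have "\<phi> (A ** B) = \<phi> A \<otimes>\<^bsub>?H\<^esub> \<phi> B"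
      using equiv_class_eq[OF equiv_loop_equiv based_loop_mult[OF AB]] AB
      by (simp add: \<phi>_def pi1_mult_class based_loop_loops)
    then show "\<phi> (A \<otimes>\<^bsub>?G\<^esub> B) = \<phi> A \<otimes>\<^bsub>?H\<^esub> \<phi> B"
      by (simp add: SL2_def)
  qed
  then interpret group_hom ?G ?H \<phi>
    by (simp add: group_hom_def group_hom_axioms_def group_SL2 group_pi1_SL2)
  have "\<phi> ` carrier ?G = carrier ?H"
  proof
    show "carrier ?H \<subseteq> \<phi> ` carrier ?G"
    proof
      fix X
      assume "X \<in> carrier ?H"
      then obtain \<alpha> where \<alpha>: "\<alpha> \<in> loops" "X = loop_equiv `` {\<alpha>}" by (rule pi1_carrierE)
      then obtain A where "A \<in> SL2_set" "based_loop A = \<alpha>" by (elim based_loop_surj)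
      with \<alpha> show "X \<in> \<phi> ` carrier ?G" by (auto simp: \<phi>_def SL2_def)
    qed
  qed auto
  moreover have "kernel ?G ?H \<phi> = QL2"
  proof -
    have "\<phi> A = \<one>\<^bsub>?H\<^esub> \<longleftrightarrow> A \<in> QL2" if "A \<in> SL2_set" for A
      using that eq_equiv_class_iff[OF equiv_loop_equiv, of "mat 1" "based_loop A"]
      by (simp add: \<phi>_def pi1_one based_loop_loops loops_closed based_loop_contractible_iff
          eq_commute[of "loop_equiv `` {based_loop A}"])
    then show ?thesis
      by (auto simp: kernel_def SL2_def QL2_def)
  qed
  \<comment> \<open>First isomorphism theorem: the homomorphism is onto with kernel
    \<open>QL2\<close>.\<close>
  ultimately show ?thesis
    using FactGroup_iso by (simp add: cohomotopy_group_def)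
qed

end
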